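(* Let $d\ge1$ and let $G=(V,E)$ be a graph on at least $d+1$ vertices that is rigid in $\mathbb{R}^d$. Then the $d$-separators of $G$ are pairwise noncrossing: there are no two $d$-separators $S,T$ of $G$ such that $S$ contains vertices from at least two different components of $G-T$.
   Context: A $d$-separator of $G$ is a set $S\subseteq V$ with $|S|=d$ such that $G-S$ is disconnected. A $d$-dimensional realization of $G$ is a pair $(G,p)$ with $p:V\to\mathbb{R}^d$; it is generic if the $d|V|$ coordinates of $p$ are algebraically independent over $\mathbb{Q}$. $(G,p),(G,q)$ are equivalent if $\|p(x)-p(y)\|=\|q(x)-q(y)\|$ for all edges $xy$, congruent if this holds for all pairs of vertices. $G$ is rigid in $\mathbb{R}^d$ if for a generic realization $(G,p)$ there is $\varepsilon>0$ such that every equivalent $(G,q)$ with $\|p(x)-q(x)\|<\varepsilon$ for all $x$ is congruent to $(G,p)$. *)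

theory Defs
  imports "HOL-Analysis.Analysis" "HOL-Library.Poly_Mapping"
begin

section \<open>Graphs\<close>

text \<open>A finite simple graph has the finite type \<open>'v\<close> as its vertex set; its edges are given by
  a symmetric irreflexive adjacency relation \<open>E\<close>, an edge \<open>xy\<close> being represented by the two
  pairs \<open>(x, y)\<close> and \<open>(y, x)\<close>.\<close>

definition simple_graph :: "'v::finite rel \<Rightarrow> bool" where
  "simple_graph E \<longleftrightarrow> sym E \<and> irrefl E"

text \<open>Vertex sets of the connected components of the graph obtained by deleting the vertices in
  \<open>S\<close>; \<open>Restr E (- S)\<close> is its edge relation.\<close>

definition components_minus :: "'v::finite rel \<Rightarrow> 'v set \<Rightarrow> 'v set set" where
  "components_minus E S = (- S) // ((Restr E (- S))\<^sup>*)"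

definition separator :: "nat \<Rightarrow> 'v::finite rel \<Rightarrow> 'v set \<Rightarrow> bool" where
  "separator d E S \<longleftrightarrow> card S = d \<and>
     (\<exists>C\<in>components_minus E S. \<exists>D\<in>components_minus E S. C \<noteq> D)"

definition crosses :: "'v::finite rel \<Rightarrow> 'v set \<Rightarrow> 'v set \<Rightarrow> bool" where
  "crosses E S T \<longleftrightarrow>
     (\<exists>C\<in>components_minus E T. \<exists>D\<in>components_minus E T.
        C \<noteq> D \<and> S \<inter> C \<noteq> {} \<and> S \<inter> D \<noteq> {})"


section \<open>Algebraic independence over the rationals\<close>

text \<open>A polynomial with rational coefficients in variables indexed by \<open>'i\<close> is a finitely supported
  map from monomials to coefficients, a monomial being a finitely supported map from variables to
  exponents.\<close>

type_synonym 'i rat_mpoly = "('i \<Rightarrow>\<^sub>0 nat) \<Rightarrow>\<^sub>0 rat"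

definition eval_mpoly :: "('i \<Rightarrow> real) \<Rightarrow> 'i rat_mpoly \<Rightarrow> real" where
  "eval_mpoly x f =
     (\<Sum>m\<in>Poly_Mapping.keys f. of_rat (Poly_Mapping.lookup f m) *
        (\<Prod>i\<in>Poly_Mapping.keys m. x i ^ Poly_Mapping.lookup m i))"

definition algebraically_independent :: "('i \<Rightarrow> real) \<Rightarrow> bool" where
  "algebraically_independent x \<longleftrightarrow> (\<forall>f. eval_mpoly x f = 0 \<longrightarrow> f = 0)"


section \<open>Realizations and rigidity\<close>

text \<open>A realization in dimension \<open>d = CARD('n)\<close> is a map \<open>p :: 'v \<Rightarrow> real ^ 'n\<close>.\<close>

definition generic :: "('v::finite \<Rightarrow> real ^ 'n::finite) \<Rightarrow> bool" where
  "generic p \<longleftrightarrow> algebraically_independent (\<lambda>(v, i). p v $ i)"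

definition equivalent_realizations ::
    "'v::finite rel \<Rightarrow> ('v \<Rightarrow> real ^ 'n::finite) \<Rightarrow> ('v \<Rightarrow> real ^ 'n) \<Rightarrow> bool" where
  "equivalent_realizations E p q \<longleftrightarrow>
     (\<forall>(x, y)\<in>E. norm (p x - p y) = norm (q x - q y))"

definition congruent_realizations ::
    "('v::finite \<Rightarrow> real ^ 'n::finite) \<Rightarrow> ('v \<Rightarrow> real ^ 'n) \<Rightarrow> bool" where
  "congruent_realizations p q \<longleftrightarrow> (\<forall>x y. norm (p x - p y) = norm (q x - q y))"

definition rigid_realization ::
    "'v::finite rel \<Rightarrow> ('v \<Rightarrow> real ^ 'n::finite) \<Rightarrow> bool" where
  "rigid_realization E p \<longleftrightarrow>
     (\<exists>\<epsilon>>0. \<forall>q. equivalent_realizations E p q \<longrightarrow> (\<forall>x. norm (p x - q x) < \<epsilon>) \<longrightarrow>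
        congruent_realizations p q)"

text \<open>Rigidity of realizations is a generic property: either all generic realizations of a graph are
  rigid or none is. Hence "for a generic realization" may be read as "for some" or as "for every";
  as rigidity will be a hypothesis, the formally weaker existential reading is used.\<close>

definition rigid :: "'n::finite itself \<Rightarrow> 'v::finite rel \<Rightarrow> bool" where
  "rigid _ E \<longleftrightarrow> (\<exists>p :: 'v \<Rightarrow> real ^ 'n. generic p \<and> rigid_realization E p)"

end

theory Submission
  imports Defs
begin

text \<open>The idea is to exhibit, for a realization \<open>P\<close> near a generic one, an explicit infinitesimal
  flex \<open>u P\<close> depending continuously on \<open>P\<close>. Since \<open>P + t u P\<close> and \<open>P - t u P\<close> are equivalent, and
  Brouwer's theorem shows that every given generic realization is of the form \<open>P + t u P\<close> for all
  small \<open>t > 0\<close>, a nontrivial \<open>u\<close> contradicts rigidity.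

  Let \<open>V = A \<union> S \<union> B = C \<union> T \<union> D\<close> be the partitions given by two crossing separators, and write
  \<open>f \<and> g\<close> for the infinitesimal rotation defined by two affine functionals, which fixes their common
  zeros. Let \<open>\<mu>\<close> and \<open>\<nu>\<close> be affine functionals vanishing on \<open>S\<close> and \<open>T\<close>, let \<open>\<phi>\<close> agree on \<open>S\<close> with \<open>\<nu>\<close>
  inside \<open>C\<close> and with \<open>0\<close> outside \<open>C\<close>, and let \<open>\<psi>\<close> agree on \<open>T\<close> with \<open>\<mu>\<close> inside \<open>A\<close> and with \<open>0\<close>
  outside \<open>A\<close>. Keep \<open>B \<inter> D\<close> fixed, and move \<open>B \<inter> C\<close> by \<open>\<nu> \<and> \<psi>\<close>, \<open>A \<inter> D\<close> by \<open>\<phi> \<and> \<mu>\<close>, and \<open>A \<inter> C\<close> by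
  \<open>\<nu> \<and> \<psi> + \<phi> \<and> \<mu> - \<nu> \<and> \<mu>\<close>. These four motions agree on the common boundaries, so they form a flex. It
  is nontrivial if the fixed part of \<open>S \<union> T\<close> has at least \<open>d\<close> points, which holds after exchanging
  \<open>(A, C)\<close> with \<open>(B, D)\<close> if necessary.

  The sets \<open>T \<inter> A\<close> and \<open>T \<inter> B\<close> are nonempty: a component of \<open>G - S\<close> avoiding \<open>T\<close> would not be adjacent
  to some \<open>s \<in> S\<close>, and could rotate about the flat spanned by \<open>S - {s}\<close>.\<close>

section \<open>Rational polynomials at generic points\<close>

text \<open>Zero coefficients and zero exponents contribute nothing, so polynomials with different
  supports can be compared over one index set.\<close>

lemma eval_mpoly_superset:
  assumes "finite A" "Poly_Mapping.keys f \<subseteq> A"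
  shows "eval_mpoly (x :: 'i::finite \<Rightarrow> real) f =
    (\<Sum>m\<in>A. of_rat (Poly_Mapping.lookup f m) * (\<Prod>i\<in>UNIV. x i ^ Poly_Mapping.lookup m i))"
proof -
  have "(\<Prod>i\<in>Poly_Mapping.keys m. x i ^ Poly_Mapping.lookup m i) =
      (\<Prod>i\<in>UNIV. x i ^ Poly_Mapping.lookup m i)" for m :: "'i \<Rightarrow>\<^sub>0 nat"
    by (rule prod.mono_neutral_left) (auto simp: in_keys_iff)
  then have "eval_mpoly x f = (\<Sum>m\<in>Poly_Mapping.keys f. of_rat (Poly_Mapping.lookup f m) *
      (\<Prod>i\<in>UNIV. x i ^ Poly_Mapping.lookup m i))"
    by (simp add: eval_mpoly_def)
  also have "\<dots> = (\<Sum>m\<in>A. of_rat (Poly_Mapping.lookup f m) *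
      (\<Prod>i\<in>UNIV. x i ^ Poly_Mapping.lookup m i))"
    using assms by (intro sum.mono_neutral_left) (auto simp: in_keys_iff)
  finally show ?thesis .
qed

lemma eval_mpoly_single:
  "eval_mpoly (x :: 'i::finite \<Rightarrow> real) (Poly_Mapping.single m a) =
    of_rat a * (\<Prod>i\<in>UNIV. x i ^ Poly_Mapping.lookup m i)"
  using eval_mpoly_superset[of "{m}" "Poly_Mapping.single m a" x] by simp

lemma eval_mpoly_0: "eval_mpoly x 0 = 0"
  by (simp add: eval_mpoly_def)

lemma eval_mpoly_add:
  "eval_mpoly (x :: 'i::finite \<Rightarrow> real) (f + g) = eval_mpoly x f + eval_mpoly x g"
proof -
  let ?A = "Poly_Mapping.keys f \<union> Poly_Mapping.keys g"
  have "Poly_Mapping.keys (f + g) \<subseteq> ?A"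
    by (rule keys_add)
  then show ?thesis
    by (subst (1 2 3) eval_mpoly_superset[of ?A])
      (auto simp: lookup_add of_rat_add algebra_simps sum.distrib)
qed

lemma eval_mpoly_sum:
  "eval_mpoly (x :: 'i::finite \<Rightarrow> real) (\<Sum>a\<in>A. f a) = (\<Sum>a\<in>A. eval_mpoly x (f a))"
  by (induction A rule: infinite_finite_induct) (auto simp: eval_mpoly_0 eval_mpoly_add)

lemma poly_mapping_eq_sum_single:
  "f = (\<Sum>m\<in>Poly_Mapping.keys f. Poly_Mapping.single m (Poly_Mapping.lookup f m))"
  by (rule poly_mapping_eqI) (auto simp: lookup_sum lookup_single when_def in_keys_iff)

lemma eval_mpoly_mult:
  "eval_mpoly (x :: 'i::finite \<Rightarrow> real) (f * g) = eval_mpoly x f * eval_mpoly x g"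
proof -
  have single: "eval_mpoly x (Poly_Mapping.single m a * Poly_Mapping.single m' b) =
      eval_mpoly x (Poly_Mapping.single m a) * eval_mpoly x (Poly_Mapping.single m' b)" for m m' a b
    by (simp add: mult_single eval_mpoly_single lookup_add power_add prod.distrib of_rat_mult)
  let ?s = "\<lambda>f m. Poly_Mapping.single m (Poly_Mapping.lookup f m)"
  have "eval_mpoly x ((\<Sum>m\<in>Poly_Mapping.keys f. ?s f m) * (\<Sum>m\<in>Poly_Mapping.keys g. ?s g m)) =
      eval_mpoly x (\<Sum>m\<in>Poly_Mapping.keys f. ?s f m) * eval_mpoly x (\<Sum>m\<in>Poly_Mapping.keys g. ?s g m)"
    by (simp add: sum_product eval_mpoly_sum single)
  then show ?thesis
    by (simp flip: poly_mapping_eq_sum_single)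
qed

text \<open>Passing to the functions defined by polynomials gives closure rules that apply directly
  to determinants.\<close>

definition rat_polynomial :: "(('i \<Rightarrow> real) \<Rightarrow> real) \<Rightarrow> bool" where
  "rat_polynomial h \<longleftrightarrow> (\<exists>f. \<forall>x. h x = eval_mpoly x f)"

lemma rat_polynomial_var: "rat_polynomial (\<lambda>x :: 'i::finite \<Rightarrow> real. x i)"
proof -
  have "x i = eval_mpoly x (Poly_Mapping.single (Poly_Mapping.single i 1) 1)" for x :: "'i \<Rightarrow> real"
  proof -
    have "(\<Prod>j\<in>UNIV. x j ^ Poly_Mapping.lookup (Poly_Mapping.single i 1) j) =
        (\<Prod>j\<in>UNIV. if i = j then x j else 1)"
      by (rule prod.cong) (auto simp: lookup_single)
    then show ?thesis
      by (simp add: eval_mpoly_single)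
  qed
  then show ?thesis
    unfolding rat_polynomial_def by blast
qed

lemma rat_polynomial_const: "rat_polynomial (\<lambda>x :: 'i::finite \<Rightarrow> real. of_rat c)"
proof -
  have "of_rat c = eval_mpoly x (Poly_Mapping.single 0 c)" for x :: "'i \<Rightarrow> real"
    by (simp add: eval_mpoly_single)
  then show ?thesis
    unfolding rat_polynomial_def by blast
qed

lemma rat_polynomial_add:
  "rat_polynomial h \<Longrightarrow> rat_polynomial k \<Longrightarrow> rat_polynomial (\<lambda>x :: 'i::finite \<Rightarrow> real. h x + k x)"
  unfolding rat_polynomial_def by (metis eval_mpoly_add)

lemma rat_polynomial_mult:
  "rat_polynomial h \<Longrightarrow> rat_polynomial k \<Longrightarrow> rat_polynomial (\<lambda>x :: 'i::finite \<Rightarrow> real. h x * k x)"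
  unfolding rat_polynomial_def by (metis eval_mpoly_mult)

lemma rat_polynomial_of_int: "rat_polynomial (\<lambda>x :: 'i::finite \<Rightarrow> real. of_int c)"
  using rat_polynomial_const[of "of_int c"] by simp

lemma rat_polynomial_diff:
  assumes "rat_polynomial h" "rat_polynomial k"
  shows "rat_polynomial (\<lambda>x :: 'i::finite \<Rightarrow> real. h x - k x)"
  using rat_polynomial_add[OF assms(1) rat_polynomial_mult[OF rat_polynomial_of_int[of "-1"] assms(2)]]
  by simp

lemma rat_polynomial_sum:
  "(\<And>a. a \<in> A \<Longrightarrow> rat_polynomial (h a)) \<Longrightarrow>
    rat_polynomial (\<lambda>x :: 'i::finite \<Rightarrow> real. \<Sum>a\<in>A. h a x)"
  using rat_polynomial_of_int[of 0]
  by (induction A rule: infinite_finite_induct) (auto intro: rat_polynomial_add)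

lemma rat_polynomial_prod:
  "(\<And>a. a \<in> A \<Longrightarrow> rat_polynomial (h a)) \<Longrightarrow>
    rat_polynomial (\<lambda>x :: 'i::finite \<Rightarrow> real. \<Prod>a\<in>A. h a x)"
  using rat_polynomial_of_int[of 1]
  by (induction A rule: infinite_finite_induct) (auto intro: rat_polynomial_mult)

lemma rat_polynomial_det:
  assumes "\<And>i j. rat_polynomial (h i j)"
  shows "rat_polynomial (\<lambda>x :: 'i::finite \<Rightarrow> real. det (\<chi> i j :: 'n::finite. h i j x))"
  unfolding det_def
  by (auto intro!: rat_polynomial_sum rat_polynomial_mult rat_polynomial_of_int rat_polynomial_prod assms)

text \<open>One point \<open>y\<close> with \<open>h y \<noteq> 0\<close> shows that the polynomial
  behind \<open>h\<close> is nonzero, so it cannot vanish at \<open>x\<close>.\<close>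

lemma algebraically_independent_nonzero:
  assumes "algebraically_independent x" "rat_polynomial h" "h y \<noteq> 0"
  shows "h x \<noteq> 0"
  using assms unfolding algebraically_independent_def rat_polynomial_def
  by (metis eval_mpoly_0)

lemma generic_det_nonzero:
  fixes p :: "'v::finite \<Rightarrow> real ^ 'n::finite" and \<tau> :: "'n \<Rightarrow> 'v"
  assumes "generic p" "inj \<tau>"
  shows "det (\<chi> i. p (\<tau> i)) \<noteq> 0"
proof -
  define h where "h = (\<lambda>x :: 'v \<times> 'n \<Rightarrow> real. det (\<chi> i j. x (\<tau> i, j)))"
  \<comment> \<open>The test point puts \<open>\<tau> i\<close> at the \<open>i\<close>-th unit
    vector and all other vertices at the origin.\<close>
  define y :: "'v \<times> 'n \<Rightarrow> real" where "y = (\<lambda>(v, i). if v = \<tau> i then 1 else 0)"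
  have "(\<chi> i j. y (\<tau> i, j)) = mat 1"
    using assms(2) by (auto simp: y_def mat_def vec_eq_iff inj_eq)
  then have "h y \<noteq> 0"
    by (simp add: h_def)
  moreover have "rat_polynomial h"
    unfolding h_def by (intro rat_polynomial_det rat_polynomial_var)
  ultimately have "h (\<lambda>(v, i). p v $ i) \<noteq> 0"
    using assms(1) algebraically_independent_nonzero unfolding generic_def by blast
  then show ?thesis
    by (simp add: h_def vec_lambda_eta)
qed

lemma generic_det_diff_nonzero:
  fixes p :: "'v::finite \<Rightarrow> real ^ 'n::finite" and \<tau> :: "'n \<Rightarrow> 'v"
  assumes "generic p" "inj \<tau>" "v \<notin> range \<tau>"
  shows "det (\<chi> i. p (\<tau> i) - p v) \<noteq> 0"
proof -
  define h where "h = (\<lambda>x :: 'v \<times> 'n \<Rightarrow> real. det (\<chi> i j. x (\<tau> i, j) - x (v, j)))"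
  \<comment> \<open>Since \<open>v\<close> is outside \<open>range \<tau>\<close>, it sits at the
    origin, and the differences are again the unit vectors.\<close>
  define y :: "'v \<times> 'n \<Rightarrow> real" where "y = (\<lambda>(v, i). if v = \<tau> i then 1 else 0)"
  have "(\<chi> i j. y (\<tau> i, j) - y (v, j)) = mat 1"
    using assms(2,3) by (auto simp: y_def mat_def vec_eq_iff inj_eq)
  then have "h y \<noteq> 0"
    by (simp add: h_def)
  moreover have "rat_polynomial h"
    unfolding h_def by (intro rat_polynomial_det rat_polynomial_diff rat_polynomial_var)
  ultimately have "h (\<lambda>(v, i). p v $ i) \<noteq> 0"
    using assms(1) algebraically_independent_nonzero unfolding generic_def by blast
  moreover have "(\<chi> i j. p (\<tau> i) $ j - p v $ j) = (\<chi> i. p (\<tau> i) - p v)"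
    by (simp add: vec_eq_iff)
  ultimately show ?thesis
    by (simp add: h_def)
qed

section \<open>Continuous infinitesimal flexes\<close>

text \<open>The given \<open>P\<close> becomes \<open>Q + t u(Q)\<close> for a fixed point \<open>Q\<close> of \<open>Q \<mapsto> P - t u(Q)\<close>.\<close>

lemma not_rigid_realization_if_flex:
  fixes P :: "real ^ 'n::finite ^ 'v::finite" and u :: "real ^ 'n ^ 'v \<Rightarrow> real ^ 'n ^ 'v"
  assumes U: "open U" "P \<in> U" and cont: "continuous_on U u"
    and flex: "\<And>Q x y. Q \<in> U \<Longrightarrow> (x, y) \<in> E \<Longrightarrow> (Q $ x - Q $ y) \<bullet> (u Q $ x - u Q $ y) = 0"
    and nontriv: "(P $ a - P $ b) \<bullet> (u P $ a - u P $ b) \<noteq> 0"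
  shows "\<not> rigid_realization E (\<lambda>v. P $ v)"
proof
  assume "rigid_realization E (\<lambda>v. P $ v)"
  then obtain \<epsilon> where "\<epsilon> > 0" and \<epsilon>: "\<And>q. equivalent_realizations E (($) P) q \<Longrightarrow>
      (\<forall>x. norm (P $ x - q x) < \<epsilon>) \<Longrightarrow> congruent_realizations (($) P) q"
    unfolding rigid_realization_def by blast
  \<comment> \<open>Nontriviality will be needed at the fixed point \<open>Q\<close> rather than at
    \<open>P\<close>, so the ball is chosen such that it holds throughout.\<close>
  let ?g = "\<lambda>Q. (Q $ a - Q $ b) \<bullet> (u Q $ a - u Q $ b)"
  have "continuous_on U ?g"
    by (intro continuous_intros cont)
  then have "open (?g -` (- {0}) \<inter> U)"
    using U by (simp add: continuous_on_open_vimage open_Compl)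
  moreover have "P \<in> ?g -` (- {0}) \<inter> U"
    using U nontriv by simp
  ultimately obtain r where "r > 0" and r: "cball P r \<subseteq> ?g -` (- {0}) \<inter> U"
    by (meson open_contains_cball)
  have cont_r: "continuous_on (cball P r) u"
    using cont r by (auto intro: continuous_on_subset)
  then have "bounded (u ` cball P r)"
    by (intro compact_imp_bounded compact_continuous_image) auto
  then obtain K where "K > 0" and K: "\<And>Q. Q \<in> cball P r \<Longrightarrow> norm (u Q) \<le> K"
    unfolding bounded_pos by auto
  \<comment> \<open>The bound \<open>r\<close> keeps the map inside the ball; the factor 1/3 keeps
    the displacement from \<open>P\<close> to \<open>q\<close>, which is twice \<open>t\<close>
    times the flex, below \<open>\<epsilon>\<close>.\<close>
  define t where "t = min r (\<epsilon> / 3) / K"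
  have t: "t > 0" "t * K \<le> r" "2 * (t * K) < \<epsilon>"
    using \<open>r > 0\<close> \<open>K > 0\<close> \<open>\<epsilon> > 0\<close> by (auto simp: t_def min_def)
  obtain Q where Q: "Q \<in> cball P r" "P - t *\<^sub>R u Q = Q"
  proof (rule brouwer_ball[OF \<open>r > 0\<close>, of P "\<lambda>Q. P - t *\<^sub>R u Q"])
    show "continuous_on (cball P r) (\<lambda>Q. P - t *\<^sub>R u Q)"
      by (intro continuous_intros cont_r)
    have "t * norm (u Q) \<le> r" if "Q \<in> cball P r" for Q
      using mult_left_mono[OF K[OF that], of t] t by linarith
    then show "(\<lambda>Q. P - t *\<^sub>R u Q) \<in> cball P r \<rightarrow> cball P r"
      using t by (auto simp: dist_norm)
  qed
  define q where "q = (\<lambda>x. Q $ x - t *\<^sub>R u Q $ x)"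
  have P: "P $ x = Q $ x + t *\<^sub>R u Q $ x" for x
  proof -
    have "P = Q + t *\<^sub>R u Q"
      using Q(2) by (simp add: algebra_simps)
    then show ?thesis
      by (metis vector_add_component vector_scaleR_component)
  qed
  \<comment> \<open>As \<open>P\<close> and \<open>q\<close> are symmetric about \<open>Q\<close>,
    the terms quadratic in \<open>t\<close> cancel: equal lengths are the same as a vanishing
    first-order term.\<close>
  have diff: "(norm (P $ x - P $ y))\<^sup>2 - (norm (q x - q y))\<^sup>2 =
      4 * t * ((Q $ x - Q $ y) \<bullet> (u Q $ x - u Q $ y))" for x y
    unfolding P q_def power2_norm_eq_inner by (simp add: algebra_simps inner_commute)
  have "norm (P $ x - P $ y) = norm (q x - q y)" if "(x, y) \<in> E" for x y
    using diff[of x y] flex[of Q x y] Q(1) r that by force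
  then have "equivalent_realizations E (($) P) q"
    unfolding equivalent_realizations_def by auto
  moreover have "norm (P $ x - q x) < \<epsilon>" for x
  proof -
    have diff_u: "P $ x - q x = (2 * t) *\<^sub>R u Q $ x"
      by (simp add: P q_def algebra_simps flip: scaleR_2)
    have "norm (u Q $ x) \<le> K"
      using K[OF Q(1)] Finite_Cartesian_Product.norm_nth_le[of "u Q" x] by linarith
    then have "2 * t * norm (u Q $ x) \<le> 2 * (t * K)"
      using t by simp
    moreover have "norm (P $ x - q x) = 2 * t * norm (u Q $ x)"
      using t diff_u by simp
    ultimately show ?thesis
      using t by linarith
  qed
  ultimately have "congruent_realizations (($) P) q"
    using \<epsilon> by blast
  then have "(Q $ a - Q $ b) \<bullet> (u Q $ a - u Q $ b) = 0"
    using diff[of a b] t by (simp add: congruent_realizations_def)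
  then show False
    using r Q(1) by auto
qed

section \<open>Infinitesimal rotations and interpolating functionals\<close>

text \<open>Storing coefficients as a pair turns continuous dependence of a functional on the
  realization into continuity into a product space.\<close>

definition affine_fun :: "real \<times> 'a::real_inner \<Rightarrow> 'a \<Rightarrow> real" where
  "affine_fun f y = fst f + snd f \<bullet> y"

definition wedge_motion :: "real \<times> 'a::real_inner \<Rightarrow> real \<times> 'a \<Rightarrow> 'a \<Rightarrow> 'a" where
  "wedge_motion f g y = affine_fun g y *\<^sub>R snd f - affine_fun f y *\<^sub>R snd g"

lemma inner_wedge_motion:
  "(y - z) \<bullet> wedge_motion f g y = affine_fun f y * affine_fun g z - affine_fun g y * affine_fun f z"
  by (simp add: wedge_motion_def affine_fun_def algebra_simps inner_commute)

text \<open>The linear part of \<open>wedge_motion f g\<close> is skew-symmetric.\<close>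

lemma inner_wedge_motion_diff:
  "(y - z) \<bullet> (wedge_motion f g y - wedge_motion f g z) = 0"
  by (simp add: wedge_motion_def affine_fun_def algebra_simps inner_commute)

text \<open>Cramer's rule makes the continuous dependence on \<open>A\<close> and \<open>b\<close> evident; the value is junk if
  \<open>det A = 0\<close>.\<close>

definition solve :: "real ^ 'n ^ 'n \<Rightarrow> real ^ 'n \<Rightarrow> real ^ 'n::finite" where
  "solve A b = (\<chi> k. det (\<chi> i j. if j = k then b $ i else A $ i $ j) / det A)"

lemma inner_solve:
  assumes "det A \<noteq> 0"
  shows "solve A b \<bullet> A $ i = b $ i"
proof -
  have "A *v solve A b = b"
    using cramer[OF assms, of "solve A b" b] by (simp add: solve_def)
  then have "(A *v solve A b) $ i = b $ i"
    by simp
  then show ?thesis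
    by (simp add: matrix_vector_mul_component inner_commute)
qed

lemma continuous_on_det [continuous_intros]:
  fixes A :: "'a::topological_space \<Rightarrow> real ^ 'n ^ 'n::finite"
  assumes "continuous_on U A"
  shows "continuous_on U (\<lambda>x. det (A x))"
  unfolding det_def by (intro continuous_intros assms)

lemma continuous_on_if_const:
  "continuous_on U f \<Longrightarrow> continuous_on U g \<Longrightarrow> continuous_on U (\<lambda>x. if b then f x else g x)"
  by (cases b) auto

lemma continuous_on_solve [continuous_intros]:
  fixes A :: "'a::topological_space \<Rightarrow> real ^ 'n ^ 'n::finite"
  assumes "continuous_on U A" "continuous_on U b" "\<And>x. x \<in> U \<Longrightarrow> det (A x) \<noteq> 0"
  shows "continuous_on U (\<lambda>x. solve (A x) (b x))"
  unfolding solve_def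
  by (intro continuous_intros continuous_on_vec_lambda continuous_on_if_const ballI assms)

definition coord_matrix :: "('n \<Rightarrow> 'v) \<Rightarrow> real ^ 'n ^ 'v \<Rightarrow> real ^ 'n ^ 'n::finite" where
  "coord_matrix \<tau> Q = (\<chi> i. Q $ \<tau> i)"

text \<open>Generic points indexed by \<open>'n\<close> are linearly independent, so that values at them can be
  interpolated by a linear functional.\<close>

definition interpolant ::
    "('n \<Rightarrow> 'v) \<Rightarrow> real ^ 'n ^ 'v \<Rightarrow> ('v \<Rightarrow> real) \<Rightarrow> real \<times> (real ^ 'n::finite)" where
  "interpolant \<tau> Q f = (0, solve (coord_matrix \<tau> Q) (\<chi> i. f (\<tau> i)))"

text \<open>Linearly independent points span a hyperplane missing the origin, so the constant term
  can be normalized to 1. This fixes the scale and makes the functional continuous in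
  \<open>Q\<close>.\<close>

definition hyperplane_fun :: "('n \<Rightarrow> 'v) \<Rightarrow> real ^ 'n ^ 'v \<Rightarrow> real \<times> (real ^ 'n::finite)" where
  "hyperplane_fun \<tau> Q = (1, - solve (coord_matrix \<tau> Q) (\<chi> i. 1))"

lemma affine_fun_interpolant:
  assumes "det (coord_matrix \<tau> Q) \<noteq> 0" "v \<in> range \<tau>"
  shows "affine_fun (interpolant \<tau> Q f) (Q $ v) = f v"
proof -
  obtain i where "v = \<tau> i"
    using assms(2) by blast
  then show ?thesis
    using inner_solve[OF assms(1), of "\<chi> i. f (\<tau> i)" i]
    by (simp add: affine_fun_def interpolant_def coord_matrix_def)
qed

lemma affine_fun_hyperplane_fun:
  assumes "det (coord_matrix \<tau> Q) \<noteq> 0" "v \<in> range \<tau>"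
  shows "affine_fun (hyperplane_fun \<tau> Q) (Q $ v) = 0"
proof -
  obtain i where "v = \<tau> i"
    using assms(2) by blast
  then show ?thesis
    using inner_solve[OF assms(1), of "\<chi> i. 1" i]
    by (simp add: affine_fun_def hyperplane_fun_def coord_matrix_def)
qed

lemma continuous_on_coord_matrix: "continuous_on U (coord_matrix \<tau>)"
  unfolding coord_matrix_def by (intro continuous_intros continuous_on_vec_lambda)

lemma open_det_coord_matrix: "open {Q. det (coord_matrix \<tau> Q) \<noteq> 0}"
proof -
  have "continuous_on UNIV (\<lambda>Q. det (coord_matrix \<tau> Q))"
    by (intro continuous_intros continuous_on_coord_matrix)
  then show ?thesis
    by (intro open_Collect_neq) auto
qed

lemma continuous_on_affine_fun [continuous_intros]:
  assumes "continuous_on U f" "continuous_on U y"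
  shows "continuous_on U (\<lambda>x. affine_fun (f x) (y x))"
  unfolding affine_fun_def by (intro continuous_intros assms)

lemma continuous_on_wedge_motion [continuous_intros]:
  assumes "continuous_on U f" "continuous_on U g" "continuous_on U y"
  shows "continuous_on U (\<lambda>x. wedge_motion (f x) (g x) (y x))"
  unfolding wedge_motion_def by (intro continuous_intros assms)

lemma continuous_on_hyperplane_fun [continuous_intros]:
  assumes "\<And>Q. Q \<in> U \<Longrightarrow> det (coord_matrix \<tau> Q) \<noteq> 0"
  shows "continuous_on U (hyperplane_fun \<tau>)"
  unfolding hyperplane_fun_def
  by (intro continuous_intros continuous_on_coord_matrix assms)

lemma continuous_on_interpolant [continuous_intros]:
  assumes "\<And>Q. Q \<in> U \<Longrightarrow> det (coord_matrix \<tau> Q) \<noteq> 0" "\<And>v. continuous_on U (\<lambda>Q. f Q v)"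
  shows "continuous_on U (\<lambda>Q. interpolant \<tau> Q (f Q))"
  unfolding interpolant_def
  by (intro continuous_intros continuous_on_vec_lambda continuous_on_coord_matrix assms)

lemma generic_coord_matrix:
  assumes "generic (($) P)" "inj \<tau>"
  shows "det (coord_matrix \<tau> P) \<noteq> 0"
  using generic_det_nonzero[OF assms] by (simp add: coord_matrix_def)

lemma inner_eq_0_det_nonzero:
  assumes "det A \<noteq> 0" "\<And>i. A $ i \<bullet> x = 0"
  shows "x = (0 :: real ^ 'n::finite)"
proof -
  have "A *v x = 0"
    using assms(2) by (simp add: vec_eq_iff matrix_vector_mul_component)
  then show ?thesis
    using assms(1) by (metis invertible_det_nz matrix_left_invertible_ker invertible_left_inverse)
qed

text \<open>Otherwise the normal of the hyperplane would be orthogonal to the independent vectors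
  \<open>P $ \<tau> i - P $ v\<close>, hence zero.\<close>

lemma generic_hyperplane_fun:
  assumes "generic (($) P)" "inj \<tau>" "v \<notin> range \<tau>"
  shows "affine_fun (hyperplane_fun \<tau> P) (P $ v) \<noteq> 0"
proof
  let ?n = "solve (coord_matrix \<tau> P) (\<chi> i. 1)"
  assume "affine_fun (hyperplane_fun \<tau> P) (P $ v) = 0"
  then have v: "?n \<bullet> P $ v = 1"
    by (simp add: affine_fun_def hyperplane_fun_def)
  have "?n \<bullet> P $ \<tau> i = 1" for i
    using inner_solve[OF generic_coord_matrix[OF assms(1,2)], of "\<chi> i. 1" i]
    by (simp add: coord_matrix_def)
  then have "(P $ \<tau> i - P $ v) \<bullet> ?n = 0" for i
    using v by (simp add: inner_diff_left inner_diff_right inner_commute)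
  then have "?n = 0"
    using generic_det_diff_nonzero[OF assms] by (intro inner_eq_0_det_nonzero) auto
  then show False
    using v by simp
qed

lemma obtain_enumeration:
  assumes "card S = CARD('n::finite)"
  obtains \<tau> :: "'n::finite \<Rightarrow> 'v::finite" where "inj \<tau>" "range \<tau> = S"
proof -
  have "\<exists>\<tau>. bij_betw \<tau> (UNIV :: 'n set) S"
    using assms by (intro finite_same_card_bij) auto
  then show ?thesis
    using that by (auto simp: bij_betw_def)
qed

section \<open>Flexes arising from separators\<close>

lemma not_rigid_realization_if_small_cut:
  fixes P :: "real ^ 'n::finite ^ 'v::finite"
  assumes gen: "generic (($) P)" and sym: "sym E" and S: "card S = CARD('n)"
    and A: "a \<in> A" "A \<inter> S = {}" and s: "s \<in> S"
    and cut: "\<And>x y. x \<in> A \<Longrightarrow> (x, y) \<in> E \<Longrightarrow> y \<in> A \<or> y \<in> S - {s}"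
  shows "\<not> rigid_realization E (($) P)"
proof -
  obtain \<sigma> :: "'n \<Rightarrow> 'v" where \<sigma>: "inj \<sigma>" "range \<sigma> = S"
    using S by (rule obtain_enumeration)
  let ?\<nu> = "hyperplane_fun \<sigma>"
  \<comment> \<open>Both functionals vanish on \<open>S - {s}\<close>, so the rotation fixes the
    attachments of \<open>A\<close>. The value 1 at \<open>s\<close> makes the first-order change
    between \<open>a\<close> and \<open>s\<close> equal to \<nu> at \<open>a\<close>, which is
    nonzero.\<close>
  let ?\<psi> = "\<lambda>Q. interpolant \<sigma> Q (\<lambda>v. if v = s then 1 else 0)"
  define u :: "real ^ 'n ^ 'v \<Rightarrow> real ^ 'n ^ 'v" where
    "u Q = (\<chi> v. if v \<in> A then wedge_motion (?\<nu> Q) (?\<psi> Q) (Q $ v) else 0)" for Q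
  define U where "U = {Q. det (coord_matrix \<sigma> Q) \<noteq> 0}"
  have \<nu>: "affine_fun (?\<nu> Q) (Q $ v) = 0" if "Q \<in> U" "v \<in> S" for Q v
    using affine_fun_hyperplane_fun[of \<sigma> Q v] that \<sigma> by (simp add: U_def)
  have \<psi>: "affine_fun (?\<psi> Q) (Q $ v) = (if v = s then 1 else 0)" if "Q \<in> U" "v \<in> S" for Q v
    using affine_fun_interpolant[of \<sigma> Q v] that \<sigma> by (simp add: U_def)
  have one_sided: "(Q $ x - Q $ y) \<bullet> (u Q $ x - u Q $ y) = 0"
    if "Q \<in> U" "(x, y) \<in> E" "x \<in> A" for Q x y
  proof (cases "y \<in> A")
    case True
    then show ?thesis
      using that by (simp add: u_def inner_wedge_motion_diff)
  next
    case False
    then have "y \<in> S" "y \<noteq> s"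
      using cut that by auto
    then show ?thesis
      using that False \<nu>[of Q y] \<psi>[of Q y] by (simp add: u_def inner_wedge_motion)
  qed
  show ?thesis
  proof (rule not_rigid_realization_if_flex[where U = U and P = P and u = u and a = a and b = s])
    show "open U"
      unfolding U_def by (rule open_det_coord_matrix)
    show "P \<in> U"
      unfolding U_def using generic_coord_matrix[OF gen \<sigma>(1)] by simp
    have "continuous_on U (\<lambda>Q. wedge_motion (?\<nu> Q) (?\<psi> Q) (Q $ v))" for v
      by (intro continuous_intros) (auto simp: U_def)
    then show "continuous_on U u"
      unfolding u_def by (intro continuous_on_vec_lambda continuous_on_if_const) auto
    show "(Q $ x - Q $ y) \<bullet> (u Q $ x - u Q $ y) = 0" if "Q \<in> U" "(x, y) \<in> E" for Q x y
    proof -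
      have "(Q $ y - Q $ x) \<bullet> (u Q $ y - u Q $ x) = (Q $ x - Q $ y) \<bullet> (u Q $ x - u Q $ y)"
        by (simp add: algebra_simps)
      moreover have "(y, x) \<in> E"
        using sym that by (auto dest: symD)
      moreover have "x \<notin> A \<Longrightarrow> y \<notin> A \<Longrightarrow> (Q $ x - Q $ y) \<bullet> (u Q $ x - u Q $ y) = 0"
        by (simp add: u_def)
      ultimately show ?thesis
        using one_sided[of Q x y] one_sided[of Q y x] that by force
    qed
    have "affine_fun (?\<nu> P) (P $ a) \<noteq> 0"
      using generic_hyperplane_fun[OF gen \<sigma>(1), of a] A \<sigma>(2) by auto
    moreover have "s \<notin> A"
      using s A by auto
    ultimately show "(P $ a - P $ s) \<bullet> (u P $ a - u P $ s) \<noteq> 0"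
      using A s \<nu>[of P s] \<psi>[of P s] \<open>P \<in> U\<close> by (simp add: u_def inner_wedge_motion)
  qed
qed

lemma not_rigid_realization_if_crossing:
  fixes P :: "real ^ 'n::finite ^ 'v::finite"
  assumes gen: "generic (($) P)" and sym: "sym E"
    and S: "card S = CARD('n)" and T: "card T = CARD('n)"
    and A: "A \<inter> S = {}" "\<And>x y. x \<in> A \<Longrightarrow> (x, y) \<in> E \<Longrightarrow> y \<in> A \<union> S"
    and C: "C \<inter> T = {}" "\<And>x y. x \<in> C \<Longrightarrow> (x, y) \<in> E \<Longrightarrow> y \<in> C \<union> T"
    and s: "s \<in> S \<inter> C" and t: "t \<in> T \<inter> A"
    and large: "card ((S - C) \<union> (T - A)) \<ge> CARD('n)"
  shows "\<not> rigid_realization E (($) P)"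
proof -
  obtain \<sigma> :: "'n \<Rightarrow> 'v" where \<sigma>: "inj \<sigma>" "range \<sigma> = S"
    using S by (rule obtain_enumeration)
  obtain \<tau> :: "'n \<Rightarrow> 'v" where \<tau>: "inj \<tau>" "range \<tau> = T"
    using T by (rule obtain_enumeration)
  let ?\<mu> = "hyperplane_fun \<sigma>" and ?\<nu> = "hyperplane_fun \<tau>"
  let ?\<phi> = "\<lambda>Q. interpolant \<sigma> Q (\<lambda>v. if v \<in> C then affine_fun (?\<nu> Q) (Q $ v) else 0)"
  let ?\<psi> = "\<lambda>Q. interpolant \<tau> Q (\<lambda>v. if v \<in> A then affine_fun (?\<mu> Q) (Q $ v) else 0)"
  let ?X = "\<lambda>Q v. wedge_motion (?\<nu> Q) (?\<psi> Q) (Q $ v)"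
  let ?Y = "\<lambda>Q v. wedge_motion (?\<phi> Q) (?\<mu> Q) (Q $ v)"
  let ?W = "\<lambda>Q v. wedge_motion (?\<nu> Q) (?\<mu> Q) (Q $ v)"
  define u :: "real ^ 'n ^ 'v \<Rightarrow> real ^ 'n ^ 'v" where
    "u Q = (\<chi> v. (if v \<in> C then ?X Q v else 0) + (if v \<in> A then ?Y Q v else 0)
      - (if v \<in> A \<inter> C then ?W Q v else 0))" for Q
  define U where "U = {Q. det (coord_matrix \<sigma> Q) \<noteq> 0} \<inter> {Q. det (coord_matrix \<tau> Q) \<noteq> 0}"
  have \<mu>: "affine_fun (?\<mu> Q) (Q $ v) = 0" if "Q \<in> U" "v \<in> S" for Q v
    using affine_fun_hyperplane_fun[of \<sigma> Q v] that \<sigma> by (simp add: U_def)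
  have \<nu>: "affine_fun (?\<nu> Q) (Q $ v) = 0" if "Q \<in> U" "v \<in> T" for Q v
    using affine_fun_hyperplane_fun[of \<tau> Q v] that \<tau> by (simp add: U_def)
  have \<phi>: "affine_fun (?\<phi> Q) (Q $ v) = (if v \<in> C then affine_fun (?\<nu> Q) (Q $ v) else 0)"
    if "Q \<in> U" "v \<in> S" for Q v
    using affine_fun_interpolant[of \<sigma> Q v] that \<sigma> by (simp add: U_def)
  have \<psi>: "affine_fun (?\<psi> Q) (Q $ v) = (if v \<in> A then affine_fun (?\<mu> Q) (Q $ v) else 0)"
    if "Q \<in> U" "v \<in> T" for Q v
    using affine_fun_interpolant[of \<tau> Q v] that \<tau> by (simp add: U_def)
  \<comment> \<open>On \<open>T\<close> the functional \<nu> vanishes, so its wedge with \<psi>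
    depends on \<psi> only through the value at the point, where \<psi> is \<mu> or 0. On
    \<open>S\<close> the same holds with \<mu> and \<phi>.\<close>
  have X: "?X Q v = (if v \<in> A then ?W Q v else 0)" if "Q \<in> U" "v \<in> T" for Q v
    using \<psi>[OF that] \<nu>[OF that] unfolding wedge_motion_def by simp
  have Y: "?Y Q v = (if v \<in> C then ?W Q v else 0)" if "Q \<in> U" "v \<in> S" for Q v
    using \<phi>[OF that] \<mu>[OF that] unfolding wedge_motion_def by simp
  have W: "?W Q v = 0" if "Q \<in> U" "v \<in> S" "v \<in> T" for Q v
    using \<mu>[of Q v] \<nu>[of Q v] that unfolding wedge_motion_def by simp
  \<comment> \<open>the motions of the four bodies; \<open>\<alpha>\<close> selects \<open>A\<close> or \<open>B\<close>, and \<open>\<gamma>\<close> selects \<open>C\<close> or \<open>D\<close>\<close>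
  define Z where "Z \<alpha> \<gamma> Q y =
      (if \<gamma> then wedge_motion (?\<nu> Q) (?\<psi> Q) y else 0) + (if \<alpha> then wedge_motion (?\<phi> Q) (?\<mu> Q) y else 0)
      - (if \<alpha> \<and> \<gamma> then wedge_motion (?\<nu> Q) (?\<mu> Q) y else 0)" for \<alpha> \<gamma> Q y
  have Z_rigid: "(y - z) \<bullet> (Z \<alpha> \<gamma> Q y - Z \<alpha> \<gamma> Q z) = 0" for \<alpha> \<gamma> Q y z
    using inner_wedge_motion_diff[of y z "?\<nu> Q" "?\<psi> Q"] inner_wedge_motion_diff[of y z "?\<phi> Q" "?\<mu> Q"]
      inner_wedge_motion_diff[of y z "?\<nu> Q" "?\<mu> Q"]
    by (cases \<alpha>; cases \<gamma>) (simp_all add: Z_def inner_diff_right inner_add_right)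
  \<comment> \<open>A vertex of \<open>S\<close> may be counted on either side of \<open>S\<close>,
    and likewise for \<open>T\<close>: this is the agreement of the four motions on their
    boundaries.\<close>
  have u_eq_Z: "u Q $ v = Z \<alpha> \<gamma> Q (Q $ v)"
    if "Q \<in> U" "v \<in> S \<or> (v \<in> A \<longleftrightarrow> \<alpha>)" "v \<in> T \<or> (v \<in> C \<longleftrightarrow> \<gamma>)" for Q v \<alpha> \<gamma>
  proof -
    have "v \<in> S \<Longrightarrow> v \<notin> A" "v \<in> T \<Longrightarrow> v \<notin> C"
      using A(1) C(1) by auto
    then show ?thesis
      using that W[of Q v] X[of Q v] Y[of Q v]
      by (cases "v \<in> S"; cases "v \<in> T"; cases \<alpha>; cases \<gamma>; cases "v \<in> A"; cases "v \<in> C")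
        (simp_all add: u_def Z_def)
  qed
  have "P \<in> U"
    unfolding U_def using generic_coord_matrix[OF gen] \<sigma> \<tau> by simp
  have "\<exists>y. (P $ s - P $ y) \<bullet> (u P $ s - u P $ y) \<noteq> 0"
  proof (rule ccontr)
    assume "\<nexists>y. (P $ s - P $ y) \<bullet> (u P $ s - u P $ y) \<noteq> 0"
    then have trivial: "(P $ s - P $ y) \<bullet> (u P $ s - u P $ y) = 0" for y
      by blast
    obtain R where R: "R \<subseteq> (S - C) \<union> (T - A)" "card R = CARD('n)"
      using large by (meson obtain_subset_with_card_n)
    obtain \<rho> :: "'n \<Rightarrow> 'v" where \<rho>: "inj \<rho>" "range \<rho> = R"
      using R(2) by (rule obtain_enumeration)
    \<comment> \<open>Vertices of \<open>R\<close> border the fixed body, the case where both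
      selectors are \<open>False\<close>. By triviality \<open>u P $ s\<close> is then orthogonal to
      independent vectors, as many as the dimension.\<close>
    have "u P $ y = 0" if "y \<in> R" for y
      using u_eq_Z[of P y False False] that R(1) A(1) C(1) \<open>P \<in> U\<close> X[of P y] Y[of P y]
      by (auto simp: Z_def)
    then have "(P $ \<rho> i - P $ s) \<bullet> u P $ s = 0" for i
      using trivial[of "\<rho> i"] \<rho>(2) by (auto simp: inner_diff_left)
    moreover have "s \<notin> range \<rho>"
      using R(1) s C(1) \<rho>(2) by auto
    ultimately have "u P $ s = 0"
      using generic_det_diff_nonzero[OF gen \<rho>(1), of s] by (intro inner_eq_0_det_nonzero) auto
    moreover have "u P $ s = ?X P s"
      using s A(1) by (auto simp: u_def)
    \<comment> \<open>Testing against \<open>t\<close> isolates a single product, because \<nu>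
      vanishes at \<open>t\<close> and \<psi> equals \<mu> there.\<close>
    ultimately have "(P $ s - P $ t) \<bullet> ?X P s = 0"
      by simp
    then have "affine_fun (?\<nu> P) (P $ s) * affine_fun (?\<mu> P) (P $ t) = 0"
      using t \<nu>[of P t] \<psi>[of P t] \<open>P \<in> U\<close> by (simp add: inner_wedge_motion)
    moreover have "affine_fun (?\<nu> P) (P $ s) \<noteq> 0"
      using generic_hyperplane_fun[OF gen \<tau>(1), of s] \<tau>(2) s C(1) by auto
    moreover have "affine_fun (?\<mu> P) (P $ t) \<noteq> 0"
      using generic_hyperplane_fun[OF gen \<sigma>(1), of t] \<sigma>(2) t A(1) by auto
    ultimately show False
      by simp
  qed
  then obtain y where y: "(P $ s - P $ y) \<bullet> (u P $ s - u P $ y) \<noteq> 0"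
    by blast
  show ?thesis
  proof (rule not_rigid_realization_if_flex[where U = U and u = u, OF _ \<open>P \<in> U\<close> _ _ y])
    show "open U"
      unfolding U_def by (intro open_Int open_det_coord_matrix)
    show "continuous_on U u"
      unfolding u_def
      by (intro continuous_on_vec_lambda continuous_intros continuous_on_if_const) (auto simp: U_def)
    show "(Q $ x - Q $ y) \<bullet> (u Q $ x - u Q $ y) = 0" if Q: "Q \<in> U" and xy: "(x, y) \<in> E" for Q x y
    proof -
      have "(y, x) \<in> E"
        using sym xy by (auto dest: symD)
      \<comment> \<open>No edge joins \<open>A\<close> to a vertex outside
        \<open>A \<union> S\<close>, so both ends can be assigned to one body, which moves
        rigidly.\<close>
      then obtain \<alpha> where \<alpha>: "x \<in> S \<or> (x \<in> A \<longleftrightarrow> \<alpha>)" "y \<in> S \<or> (y \<in> A \<longleftrightarrow> \<alpha>)"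
        using A(2)[of x y] A(2)[of y x] xy \<open>(y, x) \<in> E\<close> by blast
      obtain \<gamma> where "x \<in> T \<or> (x \<in> C \<longleftrightarrow> \<gamma>)" "y \<in> T \<or> (y \<in> C \<longleftrightarrow> \<gamma>)"
        using C(2)[of x y] C(2)[of y x] xy \<open>(y, x) \<in> E\<close> by blast
      then show ?thesis
        using u_eq_Z \<alpha> Q Z_rigid by simp
    qed
  qed
qed

section \<open>Crossing separators\<close>

lemma components_minusE:
  assumes "K \<in> components_minus E S"
  obtains x where "x \<in> K" "x \<notin> S" "K = {y. (x, y) \<in> (Restr E (- S))\<^sup>*}"
  using assms unfolding components_minus_def by (auto elim!: quotientE)

lemma components_minus_Int:
  assumes "K \<in> components_minus E S"
  shows "K \<inter> S = {}"
proof -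
  obtain x where x: "x \<notin> S" "K = {y. (x, y) \<in> (Restr E (- S))\<^sup>*}"
    using assms by (rule components_minusE)
  have "y \<notin> S" if "(x, y) \<in> (Restr E (- S))\<^sup>*" for y
    using that x(1) by (induction rule: rtrancl_induct) auto
  then show ?thesis
    using x(2) by auto
qed

lemma components_minus_closed:
  assumes "K \<in> components_minus E S" "y \<in> K" "(y, z) \<in> E"
  shows "z \<in> K \<union> S"
proof -
  obtain x where x: "K = {y. (x, y) \<in> (Restr E (- S))\<^sup>*}"
    using assms(1) by (rule components_minusE)
  show ?thesis
    using components_minus_Int[OF assms(1)] assms(2,3) unfolding x
    by (auto intro: rtrancl_into_rtrancl)
qed

lemma components_minus_disjoint:
  assumes "sym E" "K \<in> components_minus E S" "L \<in> components_minus E S" "K \<noteq> L"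
  shows "K \<inter> L = {}"
proof -
  have "sym (Restr E (- S))"
    using assms(1) by (auto simp: sym_def)
  then have "equiv UNIV ((Restr E (- S))\<^sup>*)"
    by (intro equivI refl_rtrancl sym_rtrancl trans_rtrancl) auto
  moreover have "K \<in> UNIV // (Restr E (- S))\<^sup>*" "L \<in> UNIV // (Restr E (- S))\<^sup>*"
    using assms(2,3) unfolding components_minus_def quotient_def by auto
  ultimately show ?thesis
    using quotient_disj assms(4) by blast
qed

text \<open>Membership in \<open>U\<close> spreads along paths inside the connected set
  \<open>K\<close>.\<close>

lemma component_subset_if_closed:
  assumes "sym E" "K \<in> components_minus E S" "K \<inter> U \<noteq> {}"
    and closed: "\<And>y z. y \<in> K \<inter> U \<Longrightarrow> (y, z) \<in> E \<Longrightarrow> z \<in> K \<Longrightarrow> z \<in> U"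
  shows "K \<subseteq> U"
proof -
  obtain x where x: "x \<in> K" "K = {y. (x, y) \<in> (Restr E (- S))\<^sup>*}"
    using assms(2) by (rule components_minusE)
  obtain k where k: "k \<in> K" "k \<in> U"
    using assms(3) by auto
  have "sym ((Restr E (- S))\<^sup>*)"
    using assms(1) by (intro sym_rtrancl) (auto simp: sym_def)
  then have kx: "(k, x) \<in> (Restr E (- S))\<^sup>*"
    using k(1) x(2) by (auto dest: symD)
  have "y \<in> K \<and> y \<in> U" if "(k, y) \<in> (Restr E (- S))\<^sup>*" for y
    using that
  proof (induction rule: rtrancl_induct)
    case base
    then show ?case
      using k by simp
  next
    case (step y z)
    then have "z \<in> K"
      using x(2) by (auto intro: rtrancl_into_rtrancl)
    then show ?case
      using step closed by blast
  qed
  then show ?thesis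
    using rtrancl_trans[OF kx] x(2) by blast
qed

theorem theorem4p2:
  fixes E :: "'v::finite rel"
  assumes "simple_graph E"
    and "CARD('v) \<ge> CARD('n::finite) + 1"
    and "rigid TYPE('n) E"
  shows "\<not> (\<exists>S T. separator CARD('n) E S \<and> separator CARD('n) E T \<and> crosses E S T)"
proof
  assume "\<exists>S T. separator CARD('n) E S \<and> separator CARD('n) E T \<and> crosses E S T"
  then obtain S T where S: "separator CARD('n) E S" and "separator CARD('n) E T" and "crosses E S T"
    by blast
  then have T: "card T = CARD('n)"
    by (simp add: separator_def)
  obtain C C' where C: "C \<in> components_minus E T" "C' \<in> components_minus E T" "C \<noteq> C'"
    and SC: "S \<inter> C \<noteq> {}" "S \<inter> C' \<noteq> {}"
    using \<open>crosses E S T\<close> unfolding crosses_def by blast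
  obtain A A' where A: "A \<in> components_minus E S" "A' \<in> components_minus E S" "A \<noteq> A'"
    and card_S: "card S = CARD('n)"
    using S unfolding separator_def by blast
  obtain p :: "'v \<Rightarrow> real ^ 'n" where p: "generic p" "rigid_realization E p"
    using assms(3) unfolding rigid_def by blast
  \<comment> \<open>Brouwer's theorem needs the realization as a point of a Euclidean space.\<close>
  define P :: "real ^ 'n ^ 'v" where "P = (\<chi> v. p v)"
  have "($) P = p"
    by (simp add: P_def fun_eq_iff)
  then have P: "generic (($) P)" "rigid_realization E (($) P)"
    using p by (simp_all only:)
  have sym: "sym E"
    using assms(1) by (simp add: simple_graph_def)
  have C_props: "C \<inter> T = {}" "\<And>x y. x \<in> C \<Longrightarrow> (x, y) \<in> E \<Longrightarrow> y \<in> C \<union> T"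
    using components_minus_Int[OF C(1)] components_minus_closed[OF C(1)] .
  have T_meets: "T \<inter> K \<noteq> {}" if K: "K \<in> components_minus E S" for K
  proof
    assume TK: "T \<inter> K = {}"
    obtain k where k: "k \<in> K"
      using K by (rule components_minusE)
    have "\<exists>s\<in>S. \<forall>x\<in>K. (x, s) \<notin> E"
    \<comment> \<open>As \<open>K\<close> avoids \<open>T\<close>, it lies outside \<open>C\<close>
      or inside it. A vertex of \<open>S\<close> in \<open>C\<close>, respectively in
      \<open>C'\<close>, is then separated from \<open>K\<close> by \<open>T\<close>.\<close>
    proof (cases "K \<inter> C = {}")
      case True
      obtain s where "s \<in> S" "s \<in> C"
        using SC by auto
      have "(x, s) \<notin> E" if "x \<in> K" for x
      proof
        assume "(x, s) \<in> E"
        then have "(s, x) \<in> E"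
          using sym by (auto dest: symD)
        then show False
          using C_props(2)[of s x] \<open>s \<in> C\<close> True TK that by auto
      qed
      then show ?thesis
        using \<open>s \<in> S\<close> by blast
    next
      case False
      have "K \<subseteq> C"
        using sym K False
      proof (rule component_subset_if_closed)
        show "z \<in> C" if "y \<in> K \<inter> C" "(y, z) \<in> E" "z \<in> K" for y z
          using that C_props TK by auto
      qed
      obtain s where s: "s \<in> S" "s \<in> C'"
        using SC by auto
      then have "s \<notin> C \<union> T"
        using components_minus_disjoint[OF sym C] components_minus_Int[OF C(2)] by blast
      then show ?thesis
        using C_props(2) \<open>K \<subseteq> C\<close> s(1) by blast
    qed
    then obtain s where s: "s \<in> S" "\<And>x. x \<in> K \<Longrightarrow> (x, s) \<notin> E"
      by blast
    have "\<not> rigid_realization E (($) P)"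
    proof (rule not_rigid_realization_if_small_cut[OF P(1) sym card_S k components_minus_Int[OF K] s(1)])
      show "y \<in> K \<or> y \<in> S - {s}" if "x \<in> K" "(x, y) \<in> E" for x y
        using components_minus_closed[OF K that] s(2) that by auto
    qed
    then show False
      using P(2) by blast
  qed
  \<comment> \<open>Taking all the remaining components together makes the bodies cover every
    vertex.\<close>
  define B where "B = - (A \<union> S)"
  define D where "D = - (C \<union> T)"
  have A_props: "A \<inter> S = {}" "\<And>x y. x \<in> A \<Longrightarrow> (x, y) \<in> E \<Longrightarrow> y \<in> A \<union> S"
    using components_minus_Int[OF A(1)] components_minus_closed[OF A(1)] .
  have B_props: "B \<inter> S = {}" "\<And>x y. x \<in> B \<Longrightarrow> (x, y) \<in> E \<Longrightarrow> y \<in> B \<union> S"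
    using A_props(2) symD[OF sym] unfolding B_def by blast+
  have D_props: "D \<inter> T = {}" "\<And>x y. x \<in> D \<Longrightarrow> (x, y) \<in> E \<Longrightarrow> y \<in> D \<union> T"
    using C_props(2) symD[OF sym] unfolding D_def by blast+
  have "A' \<subseteq> B"
    using components_minus_disjoint[OF sym A] components_minus_Int[OF A(2)] unfolding B_def
    by blast
  have "C' \<subseteq> D"
    using components_minus_disjoint[OF sym C] components_minus_Int[OF C(2)] unfolding D_def
    by blast
  obtain s t where st: "s \<in> S \<inter> C" "t \<in> T \<inter> A"
    using SC(1) T_meets[OF A(1)] by blast
  obtain s' t' where st': "s' \<in> S \<inter> D" "t' \<in> T \<inter> B"
    using SC(2) T_meets[OF A(2)] \<open>A' \<subseteq> B\<close> \<open>C' \<subseteq> D\<close> by blast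
  \<comment> \<open>Vertices of \<open>S \<inter> T\<close> lie in both sets and every other vertex
    of \<open>S \<union> T\<close> in exactly one. The sum is thus twice the dimension, and one of
    the two sets is large enough.\<close>
  have "card ((S - C) \<union> (T - A)) + card ((S - D) \<union> (T - B)) = card S + card T"
  proof -
    have card_Un3: "card (X \<union> Y \<union> Z) = card X + card Y + card Z"
      if "X \<inter> Y = {}" "(X \<union> Y) \<inter> Z = {}" for X Y Z :: "'v set"
      using that by (simp add: card_Un_disjoint)
    let ?M = "S \<inter> T"
    have "card S = card (S \<inter> C \<union> S \<inter> D \<union> ?M)" "card T = card (T \<inter> A \<union> T \<inter> B \<union> ?M)"
      by (rule arg_cong[where f = card]; auto simp: B_def D_def)+
    moreover have "card ((S - C) \<union> (T - A)) = card (S \<inter> D \<union> T \<inter> B \<union> ?M)"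
      "card ((S - D) \<union> (T - B)) = card (S \<inter> C \<union> T \<inter> A \<union> ?M)"
      using A_props(1) C_props(1) by (intro arg_cong[where f = card]; auto simp: B_def D_def)+
    moreover have "card (S \<inter> C \<union> S \<inter> D \<union> ?M) = card (S \<inter> C) + card (S \<inter> D) + card ?M"
      using C_props(1) by (intro card_Un3) (auto simp: D_def)
    moreover have "card (T \<inter> A \<union> T \<inter> B \<union> ?M) = card (T \<inter> A) + card (T \<inter> B) + card ?M"
      using A_props(1) by (intro card_Un3) (auto simp: B_def)
    moreover have "card (S \<inter> D \<union> T \<inter> B \<union> ?M) = card (S \<inter> D) + card (T \<inter> B) + card ?M"
      using B_props(1) D_props(1) by (intro card_Un3) auto
    moreover have "card (S \<inter> C \<union> T \<inter> A \<union> ?M) = card (S \<inter> C) + card (T \<inter> A) + card ?M"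
      using A_props(1) C_props(1) by (intro card_Un3) auto
    ultimately show ?thesis
      by linarith
  qed
  then consider "card ((S - C) \<union> (T - A)) \<ge> CARD('n)" | "card ((S - D) \<union> (T - B)) \<ge> CARD('n)"
    using card_S T by linarith
  then show False
  proof cases
    case 1
    have "\<not> rigid_realization E (($) P)"
      by (rule not_rigid_realization_if_crossing[OF P(1) sym card_S T A_props(1) _ C_props(1) _ st 1])
        (fact A_props(2) C_props(2))+
    then show False
      using P(2) by blast
  next
    case 2
    have "\<not> rigid_realization E (($) P)"
      by (rule not_rigid_realization_if_crossing[OF P(1) sym card_S T B_props(1) _ D_props(1) _ st' 2])
        (fact B_props(2) D_props(2))+
    then show False
      using P(2) by blast
  qed
qed

end
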